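(* Let $n\ge1$ and let $a\in PC(\overline{\mathbb{R}},\{0\})$. Then the spectral matrix-valued function $\phi^a:\Pi\to M_n(\mathbb{C})$ can be extended continuously to $\overline{\Pi}$.
   Context: $\overline{\mathbb{R}}=[-\infty,+\infty]$ and $\overline{\mathbb{R}}_+=[0,+\infty]$ are the two-point compactifications of $\mathbb{R}$ and $\mathbb{R}_+=(0,\infty)$; $\Pi=\mathbb{R}\times\mathbb{R}_+$, $\overline{\Pi}=\overline{\mathbb{R}}\times\overline{\mathbb{R}}_+$. $PC(\overline{\mathbb{R}},\{0\})$ is the set of all functions continuous on $\overline{\mathbb{R}}\setminus\{0\}$ and having one-sided limits at $0$. With the Hermite functions $h_m(y)=(2^m\sqrt\pi\,m!)^{-1/2}H_m(y)e^{-y^2/2}$, $H_m(y)=(-1)^me^{y^2}\frac{d^m}{dy^m}e^{-y^2}$, and $H(y)=(h_0(y),\dots,h_{n-1}(y))^T$, set $$\phi^a(t_1,t_2)=\int_{-\infty}^{\infty}a\left(\frac{-t_1+s}{2\sqrt{t_2(t_1^2+1)}}\right)H(s)[H(s)]^T\,ds,\qquad(t_1,t_2)\in\Pi.$$ *)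

theory Defs
  imports "HOL-Analysis.Analysis"
begin

definition PC :: "ereal set \<Rightarrow> (ereal \<Rightarrow> complex) set" where
  "PC E = {a. continuous_on (- E) a \<and>
              (\<forall>x\<in>E. (\<exists>l. (a \<longlongrightarrow> l) (at_left x)) \<and> (\<exists>r. (a \<longlongrightarrow> r) (at_right x)))}"

definition hermite_poly :: "nat \<Rightarrow> real \<Rightarrow> real" where
  "hermite_poly m y = (-1) ^ m * exp (y\<^sup>2) * (deriv ^^ m) (\<lambda>x. exp (- x\<^sup>2)) y"

definition hermite_fun :: "nat \<Rightarrow> real \<Rightarrow> real" where
  "hermite_fun m y =
     (2 ^ m * sqrt pi * fact m) powr (- 1 / 2) * hermite_poly m y * exp (- y\<^sup>2 / 2)"

text \<open>
  The matrices of size \<open>n\<close> are indexed by a finite linearly ordered type \<open>'n\<close> with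
  \<open>n = CARD('n)\<close>; every \<open>n \<ge> 1\<close> occurs (e.g. as a numeral type). The order identifies
  \<open>'n\<close> with \<open>{0, \<dots>, n - 1}\<close>: the number of an index is the number of its predecessors.
\<close>

definition idx :: "'n::{finite,linorder} \<Rightarrow> nat" where
  "idx i = card {..<i}"

lemma idx_less_iff [simp]:
  fixes i j :: "'a::{finite,linorder}"
  shows "idx i < idx j \<longleftrightarrow> i < j"
proof -
  have "idx i < idx j" if "i < j" for i j :: 'a
    unfolding idx_def using that by (intro psubset_card_mono) auto
  then show ?thesis
    by (metis linorder_less_linear order_less_imp_not_less)
qed

lemma bij_betw_idx: "bij_betw idx (UNIV :: 'n::{finite,linorder} set) {..<CARD('n)}"
proof -
  have inj: "inj (idx :: 'n \<Rightarrow> nat)"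
    by (rule injI) (metis idx_less_iff linorder_less_linear order_less_irrefl)
  have "idx i < CARD('n)" for i :: 'n
    unfolding idx_def by (intro psubset_card_mono) auto
  then have "range (idx :: 'n \<Rightarrow> nat) \<subseteq> {..<CARD('n)}"
    by auto
  then have "range (idx :: 'n \<Rightarrow> nat) = {..<CARD('n)}"
    by (intro card_subset_eq) (simp_all add: card_image inj)
  with inj show ?thesis
    by (simp add: bij_betw_def)
qed

definition hermite_vec :: "real \<Rightarrow> complex ^ 'n::{finite,linorder}" where
  "hermite_vec y = (\<chi> i. complex_of_real (hermite_fun (idx i) y))"

text \<open>The factor \<open>mat c\<close> multiplies a matrix by the complex scalar \<open>c\<close>.
  The type constraints make the outer product that of an \<open>n \<times> 1\<close> and a \<open>1 \<times> n\<close> matrix;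
  without them the inner dimension would be an arbitrary type.\<close>

definition spectral_fun ::
    "(ereal \<Rightarrow> complex) \<Rightarrow> real \<times> real \<Rightarrow> complex ^ 'n::{finite,linorder} ^ 'n::{finite,linorder}" where
  "spectral_fun a = (\<lambda>(t1, t2). \<integral>s. mat (a (ereal ((- t1 + s) / (2 * sqrt (t2 * (t1\<^sup>2 + 1))))))
       ** ((columnvector (hermite_vec s) :: complex ^ 1 ^ 'n::{finite,linorder})
             ** (rowvector (hermite_vec s) :: complex ^ 'n::{finite,linorder} ^ 1)) \<partial>lborel)"

definition half_plane :: "(real \<times> real) set" where
  "half_plane = UNIV \<times> {0<..}"

definition half_plane_compact :: "(ereal \<times> ereal) set" where
  "half_plane_compact = UNIV \<times> {0..}"

end

(* For real t1 the argument of a is the product of direction s t1 = (s - t1) / sqrt (t1^2 + 1)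
   and dilation t2 = 1 / (2 * sqrt t2).  The first factor extends continuously to t1 in
   [-infinity, infinity], with values -1 at infinity and 1 at -infinity, and vanishes only at
   s = t1; the second extends to a continuous map from [0, infinity] to [0, infinity].  As the
   first factor is finite and nonzero for s \<noteq> t1, the product is continuous there, with a fixed
   sign, so a may be replaced by one of its two one-sided continuous versions.  Hence the
   integrand extends continuously for almost every s, and dominated convergence applies because
   a is bounded and products of Hermite functions are integrable. *)
theory Submission
  imports Defs "HOL-Probability.Distributions" "HOL-Real_Asymp.Real_Asymp"
begin

section \<open>Hermite functions as polynomials times a Gaussian\<close>

lemma iterated_deriv_gaussian:
  "\<exists>p. (deriv ^^ m) (\<lambda>x::real. exp (- x\<^sup>2)) = (\<lambda>x. poly p x * exp (- x\<^sup>2))"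
proof (induction m)
  case 0
  show ?case by (intro exI[of _ 1]) simp
next
  case (Suc m)
  then obtain p where p: "(deriv ^^ m) (\<lambda>x::real. exp (- x\<^sup>2)) = (\<lambda>x. poly p x * exp (- x\<^sup>2))"
    by blast
  \<comment> \<open>The product rule replaces the polynomial factor p by p' - 2 x p;
    \<open>[:0, -2:]\<close> is the polynomial -2 x.\<close>
  have "((\<lambda>x. poly p x * exp (- x\<^sup>2)) has_real_derivative
      poly (pderiv p + [:0, -2:] * p) x * exp (- x\<^sup>2)) (at x)" for x
    by (auto intro!: derivative_eq_intros simp: algebra_simps)
  then have "deriv (\<lambda>x. poly p x * exp (- x\<^sup>2)) =
      (\<lambda>x. poly (pderiv p + [:0, -2:] * p) x * exp (- x\<^sup>2))"
    by (intro ext DERIV_imp_deriv)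
  then show ?case
    unfolding funpow.simps o_def p by (rule exI)
qed

text \<open>The factor exp (y^2) of the Hermite polynomial cancels the Gaussian left by the iterated
  derivative, so only a polynomial and the weight exp (- y^2 / 2) remain.\<close>

lemma hermite_fun_poly: "\<exists>p. hermite_fun m = (\<lambda>y. poly p y * exp (- y\<^sup>2 / 2))"
proof -
  obtain p where p: "(deriv ^^ m) (\<lambda>x::real. exp (- x\<^sup>2)) = (\<lambda>x. poly p x * exp (- x\<^sup>2))"
    using iterated_deriv_gaussian by blast
  have "exp (y\<^sup>2) * (q * exp (- y\<^sup>2)) = q" for y q :: real
    by (simp add: exp_minus)
  then have "hermite_poly m = (\<lambda>y. poly (smult ((-1) ^ m) p) y)"
    unfolding hermite_poly_def p by (intro ext) (simp add: mult.assoc)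
  then show ?thesis
    unfolding hermite_fun_def
    by (intro exI[of _ "smult ((2 ^ m * sqrt pi * fact m) powr (- 1 / 2)) (smult ((-1) ^ m) p)"])
      (simp add: mult.assoc)
qed

lemma continuous_on_hermite_fun [continuous_intros]:
  "continuous_on S f \<Longrightarrow> continuous_on S (\<lambda>x. hermite_fun m (f x))"
  using hermite_fun_poly[of m] by (auto intro!: continuous_intros)

text \<open>Up to the factor sqrt pi, exp (- x^2) is the normal density with mean 0 and standard
  deviation 1 / sqrt 2, all of whose moments are finite; linearity passes from monomials to
  polynomials.\<close>

lemma integrable_poly_gaussian: "integrable lborel (\<lambda>x::real. poly p x * exp (- x\<^sup>2))"
proof -
  have "integrable lborel (\<lambda>x::real. x ^ k * exp (- x\<^sup>2))" for k
  proof -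
    have "integrable lborel (\<lambda>x. sqrt pi * (normal_density 0 (1 / sqrt 2) x * (x - 0) ^ k))"
      by (intro integrable_mult_right integrable_normal_moment) simp
    then show ?thesis
      by (simp add: normal_density_def power_divide mult.commute)
  qed
  then have "integrable lborel (\<lambda>x::real. \<Sum>k\<le>degree p. coeff p k * (x ^ k * exp (- x\<^sup>2)))"
    by (intro Bochner_Integration.integrable_sum integrable_mult_right)
  then show ?thesis
    by (simp add: poly_altdef sum_distrib_right mult.assoc)
qed

lemma integrable_hermite_fun_mult:
  "integrable lborel (\<lambda>x. hermite_fun i x * hermite_fun j x)"
proof -
  obtain p q where "hermite_fun i = (\<lambda>y. poly p y * exp (- y\<^sup>2 / 2))"
    "hermite_fun j = (\<lambda>y. poly q y * exp (- y\<^sup>2 / 2))"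
    using hermite_fun_poly by metis
  moreover have "exp (- y\<^sup>2 / 2) * exp (- y\<^sup>2 / 2) = exp (- y\<^sup>2)" for y :: real
    by (simp flip: exp_add)
  ultimately have "(\<lambda>x. hermite_fun i x * hermite_fun j x) = (\<lambda>x. poly (p * q) x * exp (- x\<^sup>2))"
    by (intro ext) (simp add: mult.assoc mult.left_commute)
  then show ?thesis
    by (simp only: integrable_poly_gaussian)
qed

section \<open>The matrix-valued integrand\<close>

lemma mat_matrix_mult: "mat c ** M = (\<chi> i j. c * M $ i $ j)"
  for M :: "'a::semiring_1 ^ 'm ^ 'n"
  by (simp add: vec_eq_iff matrix_matrix_mult_def mat_def if_distrib[of "\<lambda>x. x * _"] cong: if_cong)

text \<open>The scalar comes out of both nested L2 norms, so a bound on the scalar factor of the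
  integrand is enough for a dominating function.\<close>

lemma norm_mat_matrix_mult: "norm (mat c ** M) = norm c * norm M"
  for M :: "'a::real_normed_field ^ 'm ^ 'n"
  by (simp add: mat_matrix_mult norm_vec_def norm_mult flip: L2_set_right_distrib)

type_synonym 'n cmatrix = "((complex, 'n) vec, 'n) vec"

text \<open>The factor H(s) H(s)^T of the integrand, separated because it does not depend on (t1,
  t2).\<close>

definition hermite_matrix :: "real \<Rightarrow> 'n::{finite,linorder} cmatrix" where
  "hermite_matrix s = (columnvector (hermite_vec s) :: ((complex, 1) vec, 'n) vec)
     ** (rowvector (hermite_vec s) :: ((complex, 'n) vec, 1) vec)"

lemma hermite_matrix_nth:
  "hermite_matrix s $ i $ j = complex_of_real (hermite_fun (idx i) s * hermite_fun (idx j) s)"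
  by (simp add: hermite_matrix_def matrix_matrix_mult_def columnvector_def rowvector_def hermite_vec_def)

lemma continuous_on_hermite_matrix:
  "continuous_on S (hermite_matrix :: real \<Rightarrow> 'n::{finite,linorder} cmatrix)"
proof -
  have "continuous_on S
      (\<lambda>s. \<chi> i j. complex_of_real (hermite_fun (idx i) s * hermite_fun (idx j) s) :: 'n cmatrix)"
    by (intro continuous_intros)
  then show ?thesis
    by (rule continuous_on_eq) (simp add: vec_eq_iff hermite_matrix_nth)
qed

text \<open>An L2 norm is at most the corresponding sum of norms. Applied to the rows and then to
  their entries, this gives a bound by finitely many integrable products of Hermite
  functions.\<close>

lemma integrable_norm_hermite_matrix:
  "integrable lborel (\<lambda>s. norm (hermite_matrix s :: 'n::{finite,linorder} cmatrix))"
proof (rule Bochner_Integration.integrable_bound)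
  show "integrable lborel
      (\<lambda>s. \<Sum>i::'n\<in>UNIV. \<Sum>j::'n\<in>UNIV. norm (hermite_fun (idx i) s * hermite_fun (idx j) s))"
    by (intro Bochner_Integration.integrable_sum integrable_norm integrable_hermite_fun_mult)
  show "(\<lambda>s. norm (hermite_matrix s :: 'n cmatrix)) \<in> borel_measurable lborel"
    by (simp, intro borel_measurable_continuous_onI continuous_on_norm continuous_on_hermite_matrix)
  have "norm (hermite_matrix s :: 'n cmatrix) \<le>
      (\<Sum>i::'n\<in>UNIV. \<Sum>j::'n\<in>UNIV. norm (hermite_fun (idx i) s * hermite_fun (idx j) s))" for s
  proof -
    have "norm (hermite_matrix s :: 'n cmatrix) \<le>
        (\<Sum>i::'n\<in>UNIV. norm (hermite_matrix s $ i :: (complex, 'n) vec))"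
      unfolding norm_vec_def[of "hermite_matrix s :: 'n cmatrix"] by (intro L2_set_le_sum) auto
    also have "\<dots> \<le> (\<Sum>i::'n\<in>UNIV. \<Sum>j::'n\<in>UNIV. norm (hermite_matrix s $ i $ j))"
      by (intro sum_mono, subst norm_vec_def, intro L2_set_le_sum) auto
    finally show ?thesis
      by (simp add: hermite_matrix_nth norm_mult abs_mult)
  qed
  then show "AE s in lborel. norm (norm (hermite_matrix s :: 'n cmatrix)) \<le>
      norm (\<Sum>i::'n\<in>UNIV. \<Sum>j::'n\<in>UNIV. norm (hermite_fun (idx i) s * hermite_fun (idx j) s))"
    by (intro AE_I2) (simp only: real_norm_def abs_norm_cancel order_trans[OF _ abs_ge_self])
qed

section \<open>Limits and continuity on the extended real line\<close>

lemma at_PInf_ereal: "at (\<infinity>::ereal) = filtermap ereal at_top"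
proof -
  have "UNIV - {\<infinity>::ereal} = {..<\<infinity>} - {\<infinity>}"
    by auto
  then show ?thesis
    by (simp add: at_within_def flip: at_left_PInf)
qed

lemma at_MInf_ereal: "at (-\<infinity>::ereal) = filtermap ereal at_bot"
proof -
  have "UNIV - {-\<infinity>::ereal} = {-\<infinity><..} - {-\<infinity>}"
    by auto
  then show ?thesis
    by (simp add: at_within_def flip: at_right_MInf)
qed

lemma continuous_on_UNIV_split:
  fixes f :: "'a::linorder_topology \<Rightarrow> 'b::topological_space"
  assumes "continuous_on {..<c} f" "continuous_on {c<..} f"
    and "(f \<longlongrightarrow> f c) (at_left c)" "(f \<longlongrightarrow> f c) (at_right c)"
  shows "continuous_on UNIV f"
proof -
  have "isCont f x" for x
  proof (cases x c rule: linorder_cases)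
    case equal
    then show ?thesis
      using assms(3,4) by (simp add: isCont_def filterlim_at_split)
  qed (use assms(1,2) in \<open>auto simp: continuous_on_eq_continuous_at\<close>)
  then show ?thesis
    by (simp add: continuous_on_eq_continuous_at)
qed

text \<open>Continuing by the one-sided limit removes the jump at \<open>c\<close>; the value of
  \<open>a\<close> at \<open>c\<close> itself is discarded.\<close>

lemma continuous_on_extend_right:
  fixes a :: "'a::linorder_topology \<Rightarrow> 'b::topological_space"
  assumes "continuous_on {c<..} a" "(a \<longlongrightarrow> r) (at_right c)"
  shows "continuous_on UNIV (\<lambda>x. if x \<le> c then r else a x)"
proof (rule continuous_on_UNIV_split[of c])
  let ?f = "\<lambda>x. if x \<le> c then r else a x"
  show "continuous_on {..<c} ?f"
    by (rule continuous_on_eq[OF continuous_on_const]) auto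
  show "continuous_on {c<..} ?f"
    by (rule continuous_on_eq[OF assms(1)]) auto
  show "(?f \<longlongrightarrow> ?f c) (at_left c)"
    by (rule tendsto_eventually, unfold eventually_at_filter, rule always_eventually) auto
  have "\<forall>\<^sub>F y in at_right c. a y = ?f y"
    unfolding eventually_at_filter by (intro always_eventually) auto
  then show "(?f \<longlongrightarrow> ?f c) (at_right c)"
    using assms(2) by (auto intro: Lim_transform_eventually)
qed

lemma continuous_on_extend_left:
  fixes a :: "'a::linorder_topology \<Rightarrow> 'b::topological_space"
  assumes "continuous_on {..<c} a" "(a \<longlongrightarrow> l) (at_left c)"
  shows "continuous_on UNIV (\<lambda>x. if c \<le> x then l else a x)"
proof (rule continuous_on_UNIV_split[of c])
  let ?f = "\<lambda>x. if c \<le> x then l else a x"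
  show "continuous_on {c<..} ?f"
    by (rule continuous_on_eq[OF continuous_on_const]) auto
  show "continuous_on {..<c} ?f"
    by (rule continuous_on_eq[OF assms(1)]) auto
  show "(?f \<longlongrightarrow> ?f c) (at_right c)"
    by (rule tendsto_eventually, unfold eventually_at_filter, rule always_eventually) auto
  have "\<forall>\<^sub>F y in at_left c. a y = ?f y"
    unfolding eventually_at_filter by (intro always_eventually) auto
  then show "(?f \<longlongrightarrow> ?f c) (at_left c)"
    using assms(2) by (auto intro: Lim_transform_eventually)
qed

section \<open>The two factors of the argument of \<open>a\<close>\<close>

definition direction :: "real \<Rightarrow> ereal \<Rightarrow> real" where
  "direction s x =
     (if x = \<infinity> then -1 else if x = -\<infinity> then 1
      else (s - real_of_ereal x) / sqrt ((real_of_ereal x)\<^sup>2 + 1))"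

lemma direction_ereal [simp]: "direction s (ereal r) = (s - r) / sqrt (r\<^sup>2 + 1)"
  by (simp add: direction_def)

lemma square_plus_1 [simp]:
  fixes r :: real
  shows "0 < r\<^sup>2 + 1" "\<not> r\<^sup>2 + 1 < 0" "r\<^sup>2 + 1 \<noteq> 0"
  using zero_le_power2[of r] by linarith+

text \<open>The denominator is positive for finite \<open>x\<close>, and the values -1 at
  \<infinity> and 1 at -\<infinity> fit the same comparison.\<close>

lemma direction_pos_iff: "0 < direction s x \<longleftrightarrow> x < ereal s"
  by (cases x) (simp_all add: direction_def zero_less_divide_iff not_less order.asym)

lemma direction_neg_iff: "direction s x < 0 \<longleftrightarrow> ereal s < x"
  by (cases x) (simp_all add: direction_def divide_less_0_iff not_less order.asym)

lemma continuous_on_direction: "continuous_on UNIV (direction s)"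
proof -
  have "isCont (direction s) x" for x
  proof (cases x)
    case (real r)
    have "((\<lambda>r. (s - r) / sqrt (r\<^sup>2 + 1)) \<longlongrightarrow> (s - r) / sqrt (r\<^sup>2 + 1)) (at r)"
      by (intro tendsto_intros) auto
    then show ?thesis
      unfolding real isCont_def unfolding at_ereal filterlim_filtermap by simp
  next
    case PInf
    have "((\<lambda>r. (s - r) / sqrt (r\<^sup>2 + 1)) \<longlongrightarrow> -1) at_top"
      by real_asymp
    then show ?thesis
      unfolding PInf isCont_def unfolding at_PInf_ereal filterlim_filtermap by (simp add: direction_def)
  next
    case MInf
    have "((\<lambda>r. (s - r) / sqrt (r\<^sup>2 + 1)) \<longlongrightarrow> 1) at_bot"
      by real_asymp
    then show ?thesis
      unfolding MInf isCont_def unfolding at_MInf_ereal filterlim_filtermap by (simp add: direction_def)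
  qed
  then show ?thesis
    by (simp add: continuous_on_eq_continuous_at)
qed

lemma borel_measurable_direction [measurable]: "(\<lambda>s. direction s x) \<in> borel_measurable borel"
  by (cases x) (simp_all add: direction_def)

definition ereal_sqrt :: "ereal \<Rightarrow> ereal" where
  "ereal_sqrt y = (if y = \<infinity> then \<infinity> else ereal (sqrt (real_of_ereal y)))"

lemma continuous_on_ereal_sqrt: "continuous_on {0..} ereal_sqrt"
proof -
  have "isCont ereal_sqrt y" if "y \<in> {0..}" for y
  proof (cases y)
    case (real r)
    have "((\<lambda>r. ereal (sqrt r)) \<longlongrightarrow> ereal (sqrt r)) (at r)"
      by (intro tendsto_intros)
    then show ?thesis
      unfolding real isCont_def unfolding at_ereal filterlim_filtermap by (simp add: ereal_sqrt_def)
  next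
    case PInf
    have "((\<lambda>r. ereal (sqrt r)) \<longlongrightarrow> \<infinity>) at_top"
      by (simp add: tendsto_PInfty_eq_at_top sqrt_at_top)
    then show ?thesis
      unfolding PInf isCont_def unfolding at_PInf_ereal filterlim_filtermap by (simp add: ereal_sqrt_def)
  qed (use that in auto)
  then show ?thesis
    by (simp add: continuous_at_imp_continuous_on)
qed

text \<open>On \<open>ereal\<close>, \<open>inverse\<close> sends 0 to \<infinity> and \<infinity>
  to 0, so the boundary values are the right limits without a case distinction.\<close>

definition dilation :: "ereal \<Rightarrow> ereal" where
  "dilation y = inverse (2 * ereal_sqrt y)"

lemma ereal_sqrt_nonneg: "0 \<le> y \<Longrightarrow> 0 \<le> ereal_sqrt y"
  by (cases y) (simp_all add: ereal_sqrt_def)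

text \<open>Near 0 the inverse is continuous only from the right, since its limit from the left is
  -\<infinity>; hence the composition relies on \<open>ereal_sqrt\<close> being nonnegative.\<close>

lemma continuous_on_dilation: "continuous_on {0..} dilation"
  unfolding dilation_def
  by (rule continuous_on_compose2[OF continuous_on_inverse_ereal])
    (auto intro!: continuous_on_cmult_ereal continuous_on_ereal_sqrt simp: ereal_sqrt_nonneg)

lemma dilation_ereal: "0 < r \<Longrightarrow> dilation (ereal r) = ereal (1 / (2 * sqrt r))"
  by (simp add: dilation_def ereal_sqrt_def numeral_eq_ereal inverse_eq_divide)

section \<open>The extension as an integral depending on a parameter\<close>

theorem theorem4p7:
  fixes a :: "ereal \<Rightarrow> complex"
  assumes "a \<in> PC {0}"
  shows "\<exists>\<Phi> :: ereal \<times> ereal \<Rightarrow> complex ^ 'n::{finite,linorder} ^ 'n::{finite,linorder}.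
           continuous_on half_plane_compact \<Phi> \<and>
           (\<forall>(t1, t2)\<in>half_plane. \<Phi> (ereal t1, ereal t2) = spectral_fun a (t1, t2))"
proof -
  obtain l r where a: "continuous_on (- {0}) a"
    and l: "(a \<longlongrightarrow> l) (at_left 0)" and r: "(a \<longlongrightarrow> r) (at_right 0)"
    using assms by (auto simp: PC_def)
  define a\<^sub>p where "a\<^sub>p = (\<lambda>x. if x \<le> 0 then r else a x)"
  define a\<^sub>m where "a\<^sub>m = (\<lambda>x. if 0 \<le> x then l else a x)"
  have cont_p: "continuous_on UNIV a\<^sub>p" and cont_m: "continuous_on UNIV a\<^sub>m"
    unfolding a\<^sub>p_def a\<^sub>m_def
    by (intro continuous_on_extend_right[OF _ r] continuous_on_extend_left[OF _ l]
        continuous_on_subset[OF a]; auto)+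
  have [measurable]: "a\<^sub>p \<in> borel_measurable borel" "a\<^sub>m \<in> borel_measurable borel"
    by (intro borel_measurable_continuous_onI cont_p cont_m)+
  \<comment> \<open>The branch is chosen by comparing \<open>x\<close> with \<open>s\<close>, not by
    the sign of the product: for \<open>y\<close> infinite the product is 0, and the value must then
    be the one-sided limit \<open>r\<close> or \<open>l\<close> instead of
    \<open>a 0\<close>.\<close>
  define A where "A = (\<lambda>(x, y) s.
    if x < ereal s then a\<^sub>p (ereal (direction s x) * dilation y)
    else if ereal s < x then a\<^sub>m (ereal (direction s x) * dilation y)
    else a 0)"
  \<comment> \<open>Compactness of the extended line bounds both continuous versions of
    \<open>a\<close>.\<close>
  have bounded_range: "bounded (range f)" if "continuous_on UNIV f" for f :: "ereal \<Rightarrow> complex"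
    using compact_continuous_image[OF that compact_UNIV] by (rule compact_imp_bounded)
  obtain B\<^sub>p B\<^sub>m where "\<And>x. norm (a\<^sub>p x) \<le> B\<^sub>p" "\<And>x. norm (a\<^sub>m x) \<le> B\<^sub>m"
    using bounded_range[OF cont_p] bounded_range[OF cont_m] by (auto simp: bounded_iff)
  then have "norm (A t s) \<le> max (max B\<^sub>p B\<^sub>m) (norm (a 0))" for t s
    unfolding A_def by (auto split: prod.splits simp: le_max_iff_disj)
  then obtain B where A_bound: "\<And>t s. norm (A t s) \<le> B"
    by blast
  have [measurable]: "A t \<in> borel_measurable lborel" for t
    unfolding A_def by (cases t) simp
  define F :: "ereal \<times> ereal \<Rightarrow> real \<Rightarrow> 'n cmatrix" where
    "F = (\<lambda>t s. mat (A t s) ** hermite_matrix s)"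
  have [measurable]: "F t \<in> borel_measurable lborel" for t
    unfolding F_def
  proof (rule borel_measurable_continuous_Pair[where H = "\<lambda>c M. mat c ** M"])
    show "hermite_matrix \<in> borel_measurable lborel"
      by (simp, intro borel_measurable_continuous_onI continuous_on_hermite_matrix)
    show "continuous_on UNIV (\<lambda>z :: complex \<times> 'n cmatrix. mat (fst z) ** snd z)"
      unfolding mat_matrix_mult by (intro continuous_intros)
  qed measurable
  have A_lim: "(\<lambda>k. A (u k) s) \<longlonglongrightarrow> A t s"
    if u: "\<forall>k. u k \<in> half_plane_compact" "u \<longlonglongrightarrow> t" and t: "t \<in> half_plane_compact"
      and s: "ereal s \<noteq> fst t" for u t s
  proof -
    have fst: "(\<lambda>k. fst (u k)) \<longlonglongrightarrow> fst t" and snd: "(\<lambda>k. snd (u k)) \<longlonglongrightarrow> snd t"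
      using u(2) by (auto intro: tendsto_fst tendsto_snd)
    have dir: "(\<lambda>k. direction s (fst (u k))) \<longlonglongrightarrow> direction s (fst t)"
      using continuous_on_tendsto_compose[OF continuous_on_direction fst] by simp
    \<comment> \<open>Multiplication on \<open>ereal\<close> is discontinuous only at products of 0
      and an infinity. The first factor is finite and, by this step, nonzero, so no such product
      occurs.\<close>
    have "direction s (fst t) \<noteq> 0"
      using s direction_pos_iff[of s "fst t"] direction_neg_iff[of s "fst t"] by fastforce
    moreover have "(\<lambda>k. dilation (snd (u k))) \<longlonglongrightarrow> dilation (snd t)"
      using u(1) t by (intro continuous_on_tendsto_compose[OF continuous_on_dilation snd])
        (auto simp: half_plane_compact_def mem_Times_iff)
    ultimately have lim: "(\<lambda>k. ereal (direction s (fst (u k))) * dilation (snd (u k)))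
        \<longlonglongrightarrow> ereal (direction s (fst t)) * dilation (snd t)"
      using dir by (intro tendsto_mult_ereal) auto
    show ?thesis
    proof (cases "fst t < ereal s")
      case True
      \<comment> \<open>A strict inequality persists near the limit, so \<open>A (u k) s\<close>
        eventually uses the same branch as \<open>A t s\<close>.\<close>
      then have "\<forall>\<^sub>F k in sequentially. fst (u k) < ereal s"
        by (rule order_tendstoD(2)[OF fst])
      then have "\<forall>\<^sub>F k in sequentially.
          a\<^sub>p (ereal (direction s (fst (u k))) * dilation (snd (u k))) = A (u k) s"
        by eventually_elim (simp add: A_def case_prod_unfold)
      moreover have "A t s = a\<^sub>p (ereal (direction s (fst t)) * dilation (snd t))"
        using True by (simp add: A_def case_prod_unfold)
      ultimately show ?thesis
        using continuous_on_tendsto_compose[OF cont_p lim] by (auto intro: Lim_transform_eventually)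
    next
      case False
      with s have less: "ereal s < fst t"
        by auto
      then have "\<forall>\<^sub>F k in sequentially. ereal s < fst (u k)"
        by (rule order_tendstoD(1)[OF fst])
      then have "\<forall>\<^sub>F k in sequentially.
          a\<^sub>m (ereal (direction s (fst (u k))) * dilation (snd (u k))) = A (u k) s"
        by eventually_elim (auto simp add: A_def case_prod_unfold)
      moreover have "A t s = a\<^sub>m (ereal (direction s (fst t)) * dilation (snd t))"
        using less False by (simp add: A_def case_prod_unfold)
      ultimately show ?thesis
        using continuous_on_tendsto_compose[OF cont_m lim] by (auto intro: Lim_transform_eventually)
    qed
  qed
  \<comment> \<open>The domain is first countable, so sequences suffice and dominated convergence
    applies.\<close>
  have "continuous_on half_plane_compact (\<lambda>t. \<integral>s. F t s \<partial>lborel)"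
  proof (rule continuous_on_sequentiallyI)
    fix u t
    assume u: "\<forall>k. u k \<in> half_plane_compact" "u \<longlonglongrightarrow> t" and t: "t \<in> half_plane_compact"
    show "(\<lambda>k. \<integral>s. F (u k) s \<partial>lborel) \<longlonglongrightarrow> (\<integral>s. F t s \<partial>lborel)"
    proof (rule integral_dominated_convergence)
      show "integrable lborel (\<lambda>s. B * norm (hermite_matrix s :: 'n cmatrix))"
        by (intro integrable_mult_right integrable_norm_hermite_matrix)
      show "AE s in lborel. norm (F (u k) s) \<le>
          B * norm (hermite_matrix s :: 'n cmatrix)" for k
        unfolding F_def norm_mat_matrix_mult by (intro AE_I2 mult_right_mono A_bound) simp
      have "(\<lambda>k. F (u k) s) \<longlonglongrightarrow> F t s" if "ereal s \<noteq> fst t" for s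
        unfolding F_def mat_matrix_mult by (intro tendsto_intros A_lim u t that)
      \<comment> \<open>Only s = \<open>fst t\<close> has to be excluded. If \<open>fst t\<close> is
        infinite, \<open>real_of_ereal\<close> returns 0, and a harmless single point is
        excluded.\<close>
      then show "AE s in lborel. (\<lambda>k. F (u k) s) \<longlonglongrightarrow> F t s"
        using AE_lborel_singleton[of "real_of_ereal (fst t)"] by (metis (mono_tags, lifting) AE_mp AE_I2 real_of_ereal.simps(1))
    qed measurable
  qed
  moreover have "(\<integral>s. F (ereal t1, ereal t2) s \<partial>lborel) = spectral_fun a (t1, t2)"
    if "(t1, t2) \<in> half_plane" for t1 t2
  proof -
    have "0 < t2"
      using that by (simp add: half_plane_def)
    \<comment> \<open>For positive \<open>t2\<close> the denominator is positive, so the argument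
      has the sign of s - t1 and the chosen branch returns \<open>a\<close> itself. For s = t1 the
      argument is 0, which is why \<open>A\<close> takes the value \<open>a 0\<close> there.\<close>
    have "A (ereal t1, ereal t2) s = a (ereal ((- t1 + s) / (2 * sqrt (t2 * (t1\<^sup>2 + 1)))))" for s
    proof -
      have "ereal (direction s (ereal t1)) * dilation (ereal t2) =
          ereal ((- t1 + s) / (2 * sqrt (t2 * (t1\<^sup>2 + 1))))"
        using \<open>0 < t2\<close> by (simp add: dilation_ereal real_sqrt_mult mult_ac)
      moreover have "0 < 2 * sqrt (t2 * (t1\<^sup>2 + 1))"
        using \<open>0 < t2\<close> by simp
      ultimately show ?thesis
        by (cases t1 s rule: linorder_cases)
          (simp_all add: A_def a\<^sub>p_def a\<^sub>m_def divide_le_0_iff zero_le_divide_iff zero_ereal_def)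
    qed
    then show ?thesis
      by (simp add: F_def spectral_fun_def hermite_matrix_def)
  qed
  ultimately show ?thesis
    by (intro exI[of _ "\<lambda>t. \<integral>s. F t s \<partial>lborel"]) auto
qed

end
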